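(* For a permutation $w\in\mathfrak{S}_n$, the length and the reflection length of $w$ agree, i.e. $\ell_S(w)=\ell_T(w)$, if and only if $w$ avoids both of the patterns $321$ and $3412$.
   Context: $\mathfrak{S}_n$ is the group of permutations of $\{1,\dots,n\}$. The length $\ell_S(w)$ is the minimal number of factors in an expression of $w$ as a product of adjacent transpositions $s_i=(i\ i+1)$; the reflection length $\ell_T(w)$ is the minimal number of factors in an expression of $w$ as a product of arbitrary transpositions $(i\ j)$. For $p\in\mathfrak{S}_k$, the permutation $w$ contains the pattern $p$ if there are indices $i_1<\cdots<i_k$ such that $w(i_1)\cdots w(i_k)$ is in the same relative order as $p(1)\cdots p(k)$; otherwise $w$ avoids $p$. *)

theory Defs
  imports "HOL-Combinatorics.Permutations"
begin

text \<open>Elements of the symmetric group on \<open>{1..n}\<close> are functions \<open>w :: nat \<Rightarrow> nat\<close> with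
  \<open>w permutes {1..n}\<close>; in particular they fix every number outside \<open>{1..n}\<close>.\<close>

definition adjacent_transpositions :: "nat \<Rightarrow> (nat \<Rightarrow> nat) set" where
  "adjacent_transpositions n = {transpose i (i + 1) |i. 1 \<le> i \<and> i < n}"

definition transpositions :: "nat \<Rightarrow> (nat \<Rightarrow> nat) set" where
  "transpositions n = {transpose i j |i j. 1 \<le> i \<and> i < j \<and> j \<le> n}"

text \<open>The value is unspecified when \<open>w\<close> is not a product of elements of \<open>G\<close>; this does not
  happen below, since both sets above generate the symmetric group.\<close>

definition word_length :: "('a \<Rightarrow> 'a) set \<Rightarrow> ('a \<Rightarrow> 'a) \<Rightarrow> nat" where
  "word_length G w = (LEAST k. \<exists>gs. length gs = k \<and> set gs \<subseteq> G \<and> w = foldr (\<circ>) gs id)"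

definition length_S :: "nat \<Rightarrow> (nat \<Rightarrow> nat) \<Rightarrow> nat" where
  "length_S n w = word_length (adjacent_transpositions n) w"

definition length_T :: "nat \<Rightarrow> (nat \<Rightarrow> nat) \<Rightarrow> nat" where
  "length_T n w = word_length (transpositions n) w"

definition contains_pattern :: "nat \<Rightarrow> (nat \<Rightarrow> nat) \<Rightarrow> nat \<Rightarrow> (nat \<Rightarrow> nat) \<Rightarrow> bool" where
  "contains_pattern n w k p \<longleftrightarrow>
     (\<exists>i. strict_mono_on {1..k} i \<and> i ` {1..k} \<subseteq> {1..n} \<and>
          (\<forall>a\<in>{1..k}. \<forall>b\<in>{1..k}. w (i a) < w (i b) \<longleftrightarrow> p a < p b))"

definition avoids_pattern :: "nat \<Rightarrow> (nat \<Rightarrow> nat) \<Rightarrow> nat \<Rightarrow> (nat \<Rightarrow> nat) \<Rightarrow> bool" where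
  "avoids_pattern n w k p \<longleftrightarrow> \<not> contains_pattern n w k p"

text \<open>The permutation with one-line notation \<open>xs\<close>. List indices start at 0, positions at 1.\<close>

definition one_line :: "nat list \<Rightarrow> nat \<Rightarrow> nat" where
  "one_line xs i = (if i \<in> {1..length xs} then xs ! (i - 1) else i)"

lemma one_line_321_permutes: "one_line [3, 2, 1] permutes {1..3}"
proof (rule bij_imp_permutes)
  have "{1..3::nat} = {1, 2, 3}" by auto
  then show "bij_betw (one_line [3, 2, 1]) {1..3} {1..3}"
    by (auto simp: bij_betw_def inj_on_def one_line_def)
qed (auto simp: one_line_def)

lemma one_line_3412_permutes: "one_line [3, 4, 1, 2] permutes {1..4}"
proof (rule bij_imp_permutes)
  have "{1..4::nat} = {1, 2, 3, 4}" by auto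
  then show "bij_betw (one_line [3, 4, 1, 2]) {1..4} {1..4}"
    by (auto simp: bij_betw_def inj_on_def one_line_def)
qed (auto simp: one_line_def)

end

theory Submission
  imports Defs
begin

text \<open>Write \<open>s\<^sub>i\<close> for the transposition of \<open>i\<close> and \<open>i + 1\<close>. Both sides of the equivalence
  amount to \<open>w\<close> being a product of distinct adjacent transpositions. If a reduced word repeats a
  letter, say \<open>w = a s b s c\<close>, then \<open>s b s\<close> is a product of conjugates of the letters of \<open>b\<close>,
  which saves two reflections; so equality of the lengths forces distinct letters. A product of
  distinct letters using \<open>s\<^sub>n\<close> is \<open>s\<^sub>n w'\<close> or \<open>w' s\<^sub>n\<close> with \<open>w'\<close> a product of distinct
  \<open>s\<^sub>1, \<dots>, s\<^sub>n\<^sub>-\<^sub>1\<close>, since \<open>s\<^sub>n\<close> commutes with every letter except \<open>s\<^sub>n\<^sub>-\<^sub>1\<close>, which occurs on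
  at most one side of it. Conversely, in a permutation of \<open>{1..n + 1}\<close> avoiding 321 and 3412 that
  moves \<open>n + 1\<close>, either \<open>n + 1\<close> stands in the penultimate position or \<open>n\<close> stands in the last one,
  so it has the same shape \<open>w' s\<^sub>n\<close> or \<open>s\<^sub>n w'\<close>. The reflection length of such a product exceeds
  that of \<open>w'\<close> by one, because every product of transpositions moving \<open>n + 1\<close> can be rewritten so
  that only its first factor involves \<open>n + 1\<close>.\<close>

section \<open>Words in a generating set\<close>

definition is_word_of_length :: "('a \<Rightarrow> 'a) set \<Rightarrow> nat \<Rightarrow> ('a \<Rightarrow> 'a) \<Rightarrow> bool" where
  "is_word_of_length G k w \<longleftrightarrow> (\<exists>gs. length gs = k \<and> set gs \<subseteq> G \<and> w = foldr (\<circ>) gs id)"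

lemma word_length_eq_Least: "word_length G w = (LEAST k. is_word_of_length G k w)"
  by (simp add: word_length_def is_word_of_length_def)

lemma word_length_le: "is_word_of_length G k w \<Longrightarrow> word_length G w \<le> k"
  unfolding word_length_eq_Least by (rule Least_le)

lemma is_word_of_word_length:
  "is_word_of_length G k w \<Longrightarrow> is_word_of_length G (word_length G w) w"
  unfolding word_length_eq_Least by (rule LeastI)

lemma foldr_comp_Cons: "foldr (\<circ>) (x # xs) id = x \<circ> foldr (\<circ>) xs id"
  by simp

lemma foldr_comp_append: "foldr (\<circ>) (xs @ ys) id = foldr (\<circ>) xs id \<circ> foldr (\<circ>) ys id"
  by (induction xs) (auto simp: comp_assoc)

lemma is_word_foldr: "set gs \<subseteq> G \<Longrightarrow> is_word_of_length G (length gs) (foldr (\<circ>) gs id)"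
  unfolding is_word_of_length_def by blast

lemma is_word_id: "is_word_of_length G 0 id"
  by (auto simp: is_word_of_length_def)

lemma is_word_Cons:
  assumes "g \<in> G" "is_word_of_length G k w"
  shows "is_word_of_length G (Suc k) (g \<circ> w)"
proof -
  obtain gs where "length gs = k" "set gs \<subseteq> G" "w = foldr (\<circ>) gs id"
    using assms(2) by (auto simp: is_word_of_length_def)
  with assms(1) show ?thesis
    unfolding is_word_of_length_def by (intro exI[of _ "g # gs"]) auto
qed

lemma is_word_snoc:
  assumes "g \<in> G" "is_word_of_length G k w"
  shows "is_word_of_length G (Suc k) (w \<circ> g)"
proof -
  obtain gs where "length gs = k" "set gs \<subseteq> G" "w = foldr (\<circ>) gs id"
    using assms(2) by (auto simp: is_word_of_length_def)
  with assms(1) show ?thesis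
    unfolding is_word_of_length_def
    by (intro exI[of _ "gs @ [g]"]) (auto simp: foldr_comp_append simp del: foldr_append)
qed

lemma is_word_mono: "is_word_of_length G k w \<Longrightarrow> G \<subseteq> H \<Longrightarrow> is_word_of_length H k w"
  unfolding is_word_of_length_def by blast

section \<open>Adjacent and arbitrary transpositions as permutations\<close>

lemma adjacent_transpositions_subset: "adjacent_transpositions n \<subseteq> transpositions n"
  unfolding adjacent_transpositions_def transpositions_def by fastforce

lemma adjacent_transpositions_Suc_mono:
  "adjacent_transpositions n \<subseteq> adjacent_transpositions (Suc n)"
  unfolding adjacent_transpositions_def by fastforce

lemma transpose_in_transpositions:
  assumes "a \<in> {1..n}" "b \<in> {1..n}" "a \<noteq> b"
  shows "transpose a b \<in> transpositions n"
proof (cases "a < b")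
  case True
  with assms show ?thesis unfolding transpositions_def by auto
next
  case False
  with assms have "b < a" by simp
  with assms show ?thesis
    unfolding transpositions_def using transpose_commute[of a b] by auto
qed

lemma transpositionsE:
  assumes "t \<in> transpositions n"
  obtains i j where "t = transpose i j" "i \<in> {1..n}" "j \<in> {1..n}" "i \<noteq> j"
  using assms unfolding transpositions_def by fastforce

lemma transpositions_permutes: "t \<in> transpositions n \<Longrightarrow> t permutes {1..n}"
  by (elim transpositionsE) (simp add: permutes_swap_id)

lemma foldr_comp_permutes:
  assumes "\<And>g. g \<in> set gs \<Longrightarrow> g permutes A"
  shows "foldr (\<circ>) gs id permutes A"
  using assms by (induction gs) (auto simp: permutes_id intro: permutes_compose)

lemma transpositions_foldr_permutes:
  "set gs \<subseteq> transpositions n \<Longrightarrow> foldr (\<circ>) gs id permutes {1..n}"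
  by (rule foldr_comp_permutes) (blast intro: transpositions_permutes)

section \<open>Reflection words and the largest point\<close>

lemma transpositions_Suc_cases:
  assumes "t \<in> transpositions (Suc n)"
  obtains "t \<in> transpositions n" | b where "b \<in> {1..n}" "t = transpose (Suc n) b"
proof -
  obtain i j where t: "t = transpose i j" "1 \<le> i" "i < j" "j \<le> Suc n"
    using assms by (auto simp: transpositions_def)
  show thesis
  proof (cases "j = Suc n")
    case True
    with t show thesis
      using transpose_commute[of i j] that(2)[of i] by auto
  next
    case False
    with t have "t \<in> transpositions n" by (auto intro: transpose_in_transpositions)
    then show thesis by (rule that(1))
  qed
qed

lemma permutes_Suc_fixed:
  assumes "w permutes {1..Suc n}" "w (Suc n) = Suc n"
  shows "w permutes {1..n}"
  by (rule permutes_superset[OF assms(1)]) (use assms(2) in \<open>auto simp: not_le le_Suc_eq\<close>)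

lemma comp_transpose_eq:
  assumes "bij p"
  shows "p \<circ> transpose a b = transpose (p a) (p b) \<circ> p"
  using assms by (auto simp: fun_eq_iff transpose_def bij_def inj_eq)

text \<open>Letters are added on the left, and a normal form with at most one leading letter
  involving \<open>Suc n\<close> is kept. A letter \<open>t\<close> fixing \<open>Suc n\<close>
  passes \<open>transpose (Suc n) a\<close> by conjugation, turning \<open>a\<close> into
  \<open>t a\<close>. A letter \<open>transpose (Suc n) b\<close> cancels the leading one if
  \<open>a = b\<close>; otherwise (n+1 b)(n+1 a) = (n+1 a)(a b). The number of letters never grows;
  \<open>k < length gs\<close> leaves room for the leading letter.\<close>

lemma transposition_word_Suc:
  assumes "set gs \<subseteq> transpositions (Suc n)"
  shows "(\<exists>k \<le> length gs. is_word_of_length (transpositions n) k (foldr (\<circ>) gs id)) \<or>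
    (\<exists>k < length gs. \<exists>a \<in> {1..n}. \<exists>p. is_word_of_length (transpositions n) k p \<and>
       foldr (\<circ>) gs id = transpose (Suc n) a \<circ> p)"
  using assms
proof (induction gs)
  case Nil
  show ?case using is_word_foldr[of "[]" "transpositions n"] by (auto simp: id_def)
next
  case (Cons t gs)
  let ?w = "foldr (\<circ>) gs id"
  have t: "t \<in> transpositions (Suc n)" using Cons.prems by simp
  have "set gs \<subseteq> transpositions (Suc n)" using Cons.prems by simp
  from Cons.IH[OF this] consider
    (fixed) k where "k \<le> length gs" "is_word_of_length (transpositions n) k ?w"
  | (moved) k a p where "k < length gs" "a \<in> {1..n}" "is_word_of_length (transpositions n) k p"
      "?w = transpose (Suc n) a \<circ> p"
    by blast
  then show ?case
  proof cases
    case fixed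
    from t show ?thesis
    proof (cases rule: transpositions_Suc_cases)
      case 1
      have "is_word_of_length (transpositions n) (Suc k) (t \<circ> ?w)"
        using 1 fixed by (intro is_word_Cons)
      moreover have "Suc k \<le> length (t # gs)" using fixed(1) by simp
      ultimately show ?thesis unfolding foldr_comp_Cons by blast
    next
      case (2 b)
      moreover have "k < length (t # gs)" using fixed(1) by simp
      ultimately show ?thesis using fixed(2) unfolding foldr_comp_Cons by blast
    qed
  next
    case moved
    from t show ?thesis
    proof (cases rule: transpositions_Suc_cases)
      case 1
      then have perm: "t permutes {1..n}" by (rule transpositions_permutes)
      have "t a \<in> {1..n}" using moved(2) by (simp only: permutes_in_image[OF perm])
      moreover have "t \<circ> ?w = transpose (Suc n) (t a) \<circ> (t \<circ> p)"
        using comp_transpose_eq[OF permutes_bij[OF perm], of "Suc n" a]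
          permutes_not_in[OF perm, of "Suc n"] moved(4)
        by (simp add: comp_assoc[symmetric])
      moreover have "is_word_of_length (transpositions n) (Suc k) (t \<circ> p)"
        using 1 moved by (intro is_word_Cons)
      ultimately show ?thesis
        using Suc_mono[OF moved(1)] unfolding foldr_comp_Cons length_Cons by blast
    next
      case (2 b)
      show ?thesis
      proof (cases "a = b")
        case True
        with 2 moved have "t \<circ> ?w = p" by (simp add: comp_assoc[symmetric])
        with moved(1,3) show ?thesis
          unfolding foldr_comp_Cons by (intro disjI1 exI[of _ k]) simp
      next
        case False
        have "transpose (Suc n) b \<circ> transpose (Suc n) a
            = transpose (Suc n) a \<circ> transpose a b"
          using False 2 moved(2) by (auto simp: fun_eq_iff transpose_def)
        then have "t \<circ> ?w = transpose (Suc n) a \<circ> (transpose a b \<circ> p)"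
          using 2 moved(4) by (simp add: comp_assoc[symmetric])
        moreover have "is_word_of_length (transpositions n) (Suc k) (transpose a b \<circ> p)"
          using False 2 moved by (intro is_word_Cons transpose_in_transpositions) auto
        ultimately show ?thesis
          using moved(2) Suc_mono[OF moved(1)] unfolding foldr_comp_Cons length_Cons by blast
      qed
    qed
  qed
qed

lemma is_word_permutes:
  "is_word_of_length (transpositions n) k w \<Longrightarrow> w permutes {1..n}"
  using transpositions_foldr_permutes by (auto simp only: is_word_of_length_def)

text \<open>Evaluation at \<open>Suc n\<close> determines the leading transposition of the normal
  form, so it must be the given one and cancels. This is the lower bound in the induction on
  \<open>n\<close>: moving the top point costs a further reflection.\<close>

lemma transposition_word_moved:
  assumes "is_word_of_length (transpositions (Suc n)) k (transpose (Suc n) a \<circ> p)"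
    and p: "p permutes {1..n}" and a: "a \<in> {1..n}"
  shows "\<exists>k' < k. is_word_of_length (transpositions n) k' p"
proof -
  let ?w = "transpose (Suc n) a \<circ> p"
  have val: "(transpose (Suc n) b \<circ> q) (Suc n) = b" if "q permutes {1..n}" for b q
    using permutes_not_in[OF that, of "Suc n"] by simp
  obtain gs where gs: "length gs = k" "set gs \<subseteq> transpositions (Suc n)" "?w = foldr (\<circ>) gs id"
    using assms(1) by (auto simp: is_word_of_length_def)
  from transposition_word_Suc[OF gs(2)] show ?thesis
    unfolding gs(1) gs(3)[symmetric]
  proof (elim disjE exE conjE bexE)
    fix k' assume "is_word_of_length (transpositions n) k' ?w"
    from permutes_not_in[OF is_word_permutes[OF this], of "Suc n"]
    have "?w (Suc n) = Suc n" by simp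
    with val[OF p] a show ?thesis by auto
  next
    fix k' b q
    assume k': "k' < k" and q: "is_word_of_length (transpositions n) k' q"
      and eq: "?w = transpose (Suc n) b \<circ> q"
    have "a = b"
      using val[OF p, of a] val[OF is_word_permutes[OF q], of b] eq by metis
    have "p = transpose (Suc n) a \<circ> ?w" by (simp add: comp_assoc[symmetric])
    also have "\<dots> = q" using eq \<open>a = b\<close> by (simp add: comp_assoc[symmetric])
    finally show ?thesis using k' q by blast
  qed
qed

text \<open>The normal form with a leading transposition would move \<open>Suc n\<close>. Hence
  reflections involving the extra point do not shorten words for permutations that fix it.\<close>

lemma transposition_word_fixed:
  assumes "is_word_of_length (transpositions (Suc n)) k p" and p: "p permutes {1..n}"
  shows "\<exists>k' \<le> k. is_word_of_length (transpositions n) k' p"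
proof -
  obtain gs where gs: "length gs = k" "set gs \<subseteq> transpositions (Suc n)" "p = foldr (\<circ>) gs id"
    using assms(1) by (auto simp: is_word_of_length_def)
  from transposition_word_Suc[OF gs(2)] show ?thesis
    unfolding gs(1) gs(3)[symmetric]
  proof (elim disjE exE conjE bexE)
    fix k' b q
    assume q: "is_word_of_length (transpositions n) k' q"
      and b: "b \<in> {1..n}" and eq: "p = transpose (Suc n) b \<circ> q"
    have "p (Suc n) = b"
      using permutes_not_in[OF is_word_permutes[OF q], of "Suc n"] eq by simp
    with permutes_not_in[OF p, of "Suc n"] b show ?thesis by simp
  qed blast
qed

section \<open>Generation by adjacent transpositions\<close>

text \<open>Bubble sort: with i = w(n+1), left multiplication by s_i raises the value at n+1 by one.
  The inner induction is on the distance of that value from n+1; once it vanishes, the outer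
  induction on \<open>n\<close> applies. Existence of some word ensures that the minimum in
  \<open>word_length\<close> is attained.\<close>

lemma adjacent_word_exists:
  "w permutes {1..n} \<Longrightarrow> \<exists>k. is_word_of_length (adjacent_transpositions n) k w"
proof (induction n arbitrary: w)
  case 0
  then have "w = id" by simp
  then show ?case using is_word_id by blast
next
  case (Suc n)
  from Suc.prems show ?case
  proof (induction "Suc n - w (Suc n)" arbitrary: w)
    case 0
    have "w (Suc n) \<le> Suc n"
      using permutes_in_image[OF 0(2), of "Suc n"] by simp
    with 0 have "w (Suc n) = Suc n" by simp
    with 0(2) have "w permutes {1..n}" by (rule permutes_Suc_fixed)
    with Suc.IH is_word_mono[OF _ adjacent_transpositions_Suc_mono] show ?case by blast
  next
    case (Suc m)
    define i where "i = w (Suc n)"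
    have i: "1 \<le> i" "i < Suc n"
      using permutes_in_image[OF Suc(3), of "Suc n"] Suc(2) by (auto simp: i_def)
    let ?s = "transpose i (i + 1)"
    have s: "?s \<in> adjacent_transpositions (Suc n)"
      using i by (auto simp: adjacent_transpositions_def)
    have perm: "?s \<circ> w permutes {1..Suc n}"
      using i by (intro permutes_compose[OF Suc(3)] permutes_swap_id) auto
    have "m = Suc n - (?s \<circ> w) (Suc n)"
      using Suc(2) by (simp flip: i_def)
    from Suc(1)[OF this perm] obtain k
      where "is_word_of_length (adjacent_transpositions (Suc n)) k (?s \<circ> w)" by blast
    from is_word_Cons[OF s this] show ?case by (auto simp: comp_assoc[symmetric])
  qed
qed

section \<open>Distinct letters in shortest reflection words\<close>

lemma conjugate_transposition:
  assumes "s \<in> transpositions n" "t \<in> transpositions n"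
  shows "s \<circ> t \<circ> s \<in> transpositions n"
proof -
  have s: "s permutes {1..n}" using assms(1) by (rule transpositions_permutes)
  have ss: "s \<circ> s = id" using assms(1) by (auto elim!: transpositionsE)
  obtain i j where t: "t = transpose i j" "i \<in> {1..n}" "j \<in> {1..n}" "i \<noteq> j"
    using assms(2) by (rule transpositionsE)
  have "s \<circ> t \<circ> s = transpose (s i) (s j)"
    unfolding t(1) comp_transpose_eq[OF permutes_bij[OF s]] by (simp add: comp_assoc ss)
  moreover have "s i \<in> {1..n}" "s j \<in> {1..n}" "s i \<noteq> s j"
    using t s permutes_in_image[OF s] by (auto simp: permutes_inj[THEN inj_eq])
  ultimately show ?thesis by (simp add: transpose_in_transpositions)
qed

lemma conjugate_foldr_comp:
  assumes "s \<circ> s = id"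
  shows "s \<circ> foldr (\<circ>) gs id \<circ> s = foldr (\<circ>) (map (\<lambda>g. s \<circ> g \<circ> s) gs) id"
proof (induction gs)
  case (Cons g gs)
  have "s \<circ> foldr (\<circ>) (g # gs) id \<circ> s = s \<circ> g \<circ> (s \<circ> s) \<circ> foldr (\<circ>) gs id \<circ> s"
    unfolding foldr_comp_Cons assms by (simp add: comp_assoc)
  also have "\<dots> = (s \<circ> g \<circ> s) \<circ> (s \<circ> foldr (\<circ>) gs id \<circ> s)"
    by (simp add: comp_assoc)
  finally show ?case by (simp only: Cons foldr_comp_Cons list.map)
qed (use assms in simp)

lemma distinct_of_length_T:
  assumes "set gs \<subseteq> transpositions n"
    and "length gs \<le> word_length (transpositions n) (foldr (\<circ>) gs id)"
  shows "distinct gs"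
proof (rule ccontr)
  assume "\<not> distinct gs"
  then obtain xs ys zs s where gs: "gs = xs @ [s] @ ys @ [s] @ zs"
    using not_distinct_decomp by blast
  have s: "s \<in> transpositions n" using assms(1) gs by simp
  then have ss: "s \<circ> s = id" by (auto elim!: transpositionsE)
  \<comment> \<open>Both occurrences of \<open>s\<close> are absorbed into the conjugates of the
    letters of \<open>ys\<close>, so \<open>?hs\<close> is two letters shorter than
    \<open>gs\<close>.\<close>
  let ?hs = "xs @ map (\<lambda>g. s \<circ> g \<circ> s) ys @ zs"
  have "foldr (\<circ>) gs id
      = foldr (\<circ>) xs id \<circ> (s \<circ> foldr (\<circ>) ys id \<circ> s) \<circ> foldr (\<circ>) zs id"
    unfolding gs by (simp only: foldr_comp_append) (simp add: comp_assoc)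
  also have "\<dots> = foldr (\<circ>) ?hs id"
    unfolding conjugate_foldr_comp[OF ss] by (simp only: foldr_comp_append comp_assoc)
  finally have "foldr (\<circ>) gs id = foldr (\<circ>) ?hs id" .
  moreover have "set ?hs \<subseteq> transpositions n"
    using assms(1) gs conjugate_transposition[OF s] by auto
  ultimately have "is_word_of_length (transpositions n) (length ?hs) (foldr (\<circ>) gs id)"
    unfolding is_word_of_length_def by blast
  from word_length_le[OF this] assms(2) gs show False by simp
qed

section \<open>The two patterns as inequalities\<close>

text \<open>Each pattern becomes a single chain of strict inequalities between values; the remaining
  order relations follow by transitivity. Arguments about positions then need no embedding of an
  index set.\<close>

definition avoids_321_3412 :: "nat \<Rightarrow> (nat \<Rightarrow> nat) \<Rightarrow> bool" where
  "avoids_321_3412 n w \<longleftrightarrow>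
     (\<forall>i j k. 1 \<le> i \<and> i < j \<and> j < k \<and> k \<le> n \<longrightarrow> \<not> (w k < w j \<and> w j < w i)) \<and>
     (\<forall>i j k l. 1 \<le> i \<and> i < j \<and> j < k \<and> k < l \<and> l \<le> n \<longrightarrow>
        \<not> (w k < w l \<and> w l < w i \<and> w i < w j))"

lemma contains_321_iff:
  "contains_pattern n w 3 (one_line [3, 2, 1]) \<longleftrightarrow>
   (\<exists>i j k. 1 \<le> i \<and> i < j \<and> j < k \<and> k \<le> n \<and> w k < w j \<and> w j < w i)"
  (is "?L \<longleftrightarrow> ?R")
proof
  have S: "{1..3::nat} = {1, 2, 3}" by auto
  show ?R if ?L
  proof -
    from that obtain i where i: "strict_mono_on {1..3} i" "i ` {1..3} \<subseteq> {1..n}"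
      "\<forall>a\<in>{1..3}. \<forall>b\<in>{1..3}. w (i a) < w (i b) \<longleftrightarrow> one_line [3, 2, 1] a < one_line [3, 2, 1] b"
      unfolding contains_pattern_def by blast
    have "i 1 < i 2" "i 2 < i 3" using i(1) by (auto simp: strict_mono_on_def)
    moreover have "i 1 \<in> {1..n}" "i 3 \<in> {1..n}" using i(2) by (simp_all add: image_subset_iff)
    then have "1 \<le> i 1" "i 3 \<le> n" by simp_all
    moreover have "w (i 3) < w (i 2)" "w (i 2) < w (i 1)"
      using i(3) by (auto simp: S one_line_def)
    ultimately show ?thesis by blast
  qed
  show ?L if ?R
  proof -
    from that obtain i j k where "1 \<le> i" "i < j" "j < k" "k \<le> n" "w k < w j" "w j < w i"
      by blast
    then show ?thesis
      unfolding contains_pattern_def S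
      \<comment> \<open>Here \<open>one_line\<close> serves only to list the chosen positions as a
        function on 1, 2, 3; it need not be a permutation.\<close>
      by (intro exI[of _ "one_line [i, j, k]"])
        (auto simp: one_line_def strict_mono_on_def)
  qed
qed

lemma contains_3412_iff:
  "contains_pattern n w 4 (one_line [3, 4, 1, 2]) \<longleftrightarrow>
   (\<exists>i j k l. 1 \<le> i \<and> i < j \<and> j < k \<and> k < l \<and> l \<le> n \<and>
      w k < w l \<and> w l < w i \<and> w i < w j)"
  (is "?L \<longleftrightarrow> ?R")
proof
  have S: "{1..4::nat} = {1, 2, 3, 4}" by auto
  show ?R if ?L
  proof -
    from that obtain i where i: "strict_mono_on {1..4} i" "i ` {1..4} \<subseteq> {1..n}"
      "\<forall>a\<in>{1..4}. \<forall>b\<in>{1..4}.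
         w (i a) < w (i b) \<longleftrightarrow> one_line [3, 4, 1, 2] a < one_line [3, 4, 1, 2] b"
      unfolding contains_pattern_def by blast
    have "i 1 < i 2" "i 2 < i 3" "i 3 < i 4" using i(1) by (auto simp: strict_mono_on_def)
    moreover have "i 1 \<in> {1..n}" "i 4 \<in> {1..n}" using i(2) by (simp_all add: image_subset_iff)
    then have "1 \<le> i 1" "i 4 \<le> n" by simp_all
    moreover have "w (i 3) < w (i 4)" "w (i 4) < w (i 1)" "w (i 1) < w (i 2)"
      using i(3) by (auto simp: S one_line_def)
    ultimately show ?thesis by blast
  qed
  show ?L if ?R
  proof -
    from that obtain i j k l where "1 \<le> i" "i < j" "j < k" "k < l" "l \<le> n"
      "w k < w l" "w l < w i" "w i < w j"
      by blast
    then show ?thesis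
      unfolding contains_pattern_def S
      by (intro exI[of _ "one_line [i, j, k, l]"])
        (auto simp: one_line_def strict_mono_on_def)
  qed
qed

lemma avoids_321_3412_iff:
  "avoids_321_3412 n w \<longleftrightarrow>
   avoids_pattern n w 3 (one_line [3, 2, 1]) \<and> avoids_pattern n w 4 (one_line [3, 4, 1, 2])"
  unfolding avoids_321_3412_def avoids_pattern_def contains_321_iff contains_3412_iff by blast

text \<open>An occurrence of either pattern in \<open>v\<close> is carried by \<open>f\<close> to
  one in \<open>w\<close>. One implication between the values suffices because the patterns are
  chains of strict inequalities.\<close>

lemma avoids_321_3412_embedding:
  assumes "avoids_321_3412 n w"
    and "\<And>a b. 1 \<le> a \<Longrightarrow> a < b \<Longrightarrow> b \<le> m \<Longrightarrow> f a < f b"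
    and "\<And>a. 1 \<le> a \<Longrightarrow> a \<le> m \<Longrightarrow> 1 \<le> f a \<and> f a \<le> n"
    and "\<And>a b. a \<in> {1..m} \<Longrightarrow> b \<in> {1..m} \<Longrightarrow> v a < v b \<Longrightarrow> w (f a) < w (f b)"
  shows "avoids_321_3412 m v"
  unfolding avoids_321_3412_def
proof (intro conjI allI impI notI; elim conjE)
  fix i j k assume "1 \<le> i" "i < j" "j < k" "k \<le> m" "v k < v j" "v j < v i"
  then have "1 \<le> f i" "f i < f j" "f j < f k" "f k \<le> n" "w (f k) < w (f j)" "w (f j) < w (f i)"
    using assms(2-4) by auto
  with assms(1) show False unfolding avoids_321_3412_def by blast
next
  fix i j k l assume "1 \<le> i" "i < j" "j < k" "k < l" "l \<le> m" "v k < v l" "v l < v i" "v i < v j"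
  then have "1 \<le> f i" "f i < f j" "f j < f k" "f k < f l" "f l \<le> n"
    "w (f k) < w (f l)" "w (f l) < w (f i)" "w (f i) < w (f j)"
    using assms(2-4) by auto
  with assms(1) show False unfolding avoids_321_3412_def by blast
qed

section \<open>Avoidance by products of distinct adjacent transpositions\<close>

lemma permutes_le: "p permutes {1..n} \<Longrightarrow> i \<le> n \<Longrightarrow> p i \<le> n"
  using permutes_in_image[of p "{1..n}" i] permutes_not_in[of p "{1..n}" i]
  by (cases "i \<in> {1..n}") auto

text \<open>Both patterns end in an entry smaller than some earlier one, so a maximal last entry
  belongs to no occurrence.\<close>

lemma avoids_Suc_fixed:
  assumes "p permutes {1..n}" "avoids_321_3412 n p"
  shows "avoids_321_3412 (Suc n) p"
proof -
  have top: "p (Suc n) = Suc n" using permutes_not_in[OF assms(1)] by simp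
  have le: "p i \<le> n" if "i \<le> n" for i using that permutes_le[OF assms(1)] by blast
  show ?thesis
    unfolding avoids_321_3412_def
  proof (intro conjI allI impI notI; elim conjE)
    fix i j k assume *: "1 \<le> i" "i < j" "j < k" "k \<le> Suc n" "p k < p j" "p j < p i"
    have "k \<noteq> Suc n" using * top le[of j] by auto
    with * assms(2) show False unfolding avoids_321_3412_def by (metis le_Suc_eq)
  next
    fix i j k l assume *: "1 \<le> i" "i < j" "j < k" "k < l" "l \<le> Suc n"
      "p k < p l" "p l < p i" "p i < p j"
    have "l \<noteq> Suc n" using * top le[of i] by auto
    with * assms(2) show False unfolding avoids_321_3412_def by (metis le_Suc_eq)
  qed
qed

text \<open>The one-line notation is that of \<open>p\<close> with n+1 inserted just before the last
  entry. In an occurrence this maximum could only play 3 in 321 or 4 in 3412, and both need two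
  later entries where only one is left. So every occurrence misses position \<open>n\<close>, and
  \<open>f\<close> closes the gap to give one in \<open>p\<close>.\<close>

lemma avoids_comp_top_transpose:
  assumes p: "p permutes {1..n}" and av: "avoids_321_3412 n p" and n: "1 \<le> n"
  shows "avoids_321_3412 (Suc n) (p \<circ> transpose n (Suc n))"
proof -
  let ?w = "p \<circ> transpose n (Suc n)"
  have w: "?w n = Suc n" "?w (Suc n) = p n" "\<And>i. i < n \<Longrightarrow> ?w i = p i"
    using permutes_not_in[OF p, of "Suc n"] by (auto simp: transpose_def)
  have le: "?w i \<le> n" if "i \<le> Suc n" "i \<noteq> n" for i
    using that w permutes_le[OF p] by (cases "i = Suc n") auto
  define f where "f i = (if i = Suc n then n else i)" for i
  have f: "?w i = p (f i)" if "i \<le> Suc n" "i \<noteq> n" for i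
    using that w by (auto simp: f_def)
  have fmono: "f i < f j" if "i < j" "i \<noteq> n" "j \<le> Suc n" "j \<noteq> n" for i j
    using that by (auto simp: f_def)
  have fran: "f i \<le> n" "1 \<le> i \<Longrightarrow> 1 \<le> f i" if "i \<le> Suc n" for i
    using that n by (auto simp: f_def)
  show ?thesis
    unfolding avoids_321_3412_def
  proof (intro conjI allI impI notI; elim conjE)
    fix i j k assume *: "1 \<le> i" "i < j" "j < k" "k \<le> Suc n" "?w k < ?w j" "?w j < ?w i"
    have ne: "i \<noteq> n" using * by simp
    have "j \<noteq> n" using * w(1) le[of i] ne by auto
    moreover have "k \<noteq> n" using * w(1) le[of j] \<open>j \<noteq> n\<close> by auto
    ultimately have "f i < f j" "f j < f k" "p (f k) < p (f j)" "p (f j) < p (f i)"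
      using * ne fmono f[of i] f[of j] f[of k] by auto
    with av fran[of i] fran[of k] * show False
      unfolding avoids_321_3412_def by auto
  next
    fix i j k l assume *: "1 \<le> i" "i < j" "j < k" "k < l" "l \<le> Suc n"
      "?w k < ?w l" "?w l < ?w i" "?w i < ?w j"
    have ne: "i \<noteq> n" "j \<noteq> n" using * by simp_all
    have "l \<noteq> n" using * w(1) le[of i] ne by auto
    moreover have "k \<noteq> n" using * w(1) le[of l] \<open>l \<noteq> n\<close> by auto
    ultimately have "f i < f j" "f j < f k" "f k < f l"
      "p (f k) < p (f l)" "p (f l) < p (f i)" "p (f i) < p (f j)"
      using * ne fmono f[of i] f[of j] f[of k] f[of l] by auto
    with av fran[of i] fran[of l] * show False
      unfolding avoids_321_3412_def by auto
  qed
qed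

text \<open>The last entry is \<open>n\<close>, and only one earlier entry exceeds it, whereas the
  last entry of either pattern has two larger ones before it. So an occurrence lies in the first
  \<open>n\<close> positions, where strict inequalities between values of \<open>?w\<close> hold for
  \<open>p\<close> as well.\<close>

lemma avoids_top_transpose_comp:
  assumes p: "p permutes {1..n}" and av: "avoids_321_3412 n p" and n: "1 \<le> n"
  shows "avoids_321_3412 (Suc n) (transpose n (Suc n) \<circ> p)"
proof -
  let ?w = "transpose n (Suc n) \<circ> p"
  have top: "?w (Suc n) = n" using permutes_not_in[OF p, of "Suc n"] by simp
  have eq: "?w i = (if p i = n then Suc n else p i)" and le: "p i \<le> n" if "i \<le> n" for i
    using permutes_le[OF p that] by (auto simp: transpose_def)
  have less: "p i < p j" if "i \<le> n" "j \<le> n" "?w i < ?w j" for i j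
    using that(3) le[OF that(1)] le[OF that(2)] unfolding eq[OF that(1)] eq[OF that(2)]
    by (auto split: if_splits)
  show ?thesis
    unfolding avoids_321_3412_def
  proof (intro conjI allI impI notI; elim conjE)
    fix i j k assume *: "1 \<le> i" "i < j" "j < k" "k \<le> Suc n" "?w k < ?w j" "?w j < ?w i"
    show False
    proof (cases "k = Suc n")
      case True
      then have "n < ?w j" "?w j < ?w i" using * top by auto
      with * eq[of i] eq[of j] le[of i] le[of j] show False by (auto split: if_splits)
    next
      case False
      then have "p k < p j" "p j < p i" using * less[of k j] less[of j i] by auto
      with av * False show False unfolding avoids_321_3412_def by (metis le_Suc_eq)
    qed
  next
    fix i j k l assume *: "1 \<le> i" "i < j" "j < k" "k < l" "l \<le> Suc n"
      "?w k < ?w l" "?w l < ?w i" "?w i < ?w j"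
    show False
    proof (cases "l = Suc n")
      case True
      then have "n < ?w i" "?w i < ?w j" using * top by auto
      with * eq[of i] eq[of j] le[of i] le[of j] show False by (auto split: if_splits)
    next
      case False
      then have "p k < p l" "p l < p i" "p i < p j"
        using * less[of k l] less[of l i] less[of i j] by auto
      with av * False show False unfolding avoids_321_3412_def by (metis le_Suc_eq)
    qed
  qed
qed

lemma adjacent_transpositions_Suc_cases:
  assumes "g \<in> adjacent_transpositions (Suc n)" "g \<noteq> transpose n (Suc n)"
  shows "g \<in> adjacent_transpositions n"
  using assms by (auto simp: adjacent_transpositions_def less_Suc_eq)

text \<open>Every letter s_i of the word has i < n-1, so its support is disjoint from that of
  s_n.\<close>

lemma transpose_commutes_foldr:
  assumes "set gs \<subseteq> adjacent_transpositions n" "transpose (n - 1) n \<notin> set gs"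
  shows "transpose n (Suc n) \<circ> foldr (\<circ>) gs id = foldr (\<circ>) gs id \<circ> transpose n (Suc n)"
  using assms
proof (induction gs)
  case (Cons g gs)
  obtain i where i: "g = transpose i (i + 1)" "1 \<le> i" "i < n"
    using Cons.prems(1) by (auto simp: adjacent_transpositions_def)
  have "i \<noteq> n - 1" using i Cons.prems(2) by auto
  then have "transpose n (Suc n) \<circ> g = g \<circ> transpose n (Suc n)"
    using i by (auto simp: fun_eq_iff transpose_def)
  then show ?case using Cons by (simp add: fun_eq_iff)
qed simp

lemma avoids_of_distinct:
  assumes "distinct gs" "set gs \<subseteq> adjacent_transpositions n"
  shows "avoids_321_3412 n (foldr (\<circ>) gs id)"
  using assms
proof (induction n arbitrary: gs)
  case 0
  show ?case by (simp add: avoids_321_3412_def)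
next
  case (Suc n)
  let ?s = "transpose n (Suc n)"
  have perm: "foldr (\<circ>) hs id permutes {1..n}" if "set hs \<subseteq> adjacent_transpositions n" for hs
    using that adjacent_transpositions_subset transpositions_foldr_permutes by blast
  show ?case
  proof (cases "?s \<in> set gs")
    case False
    then have "set gs \<subseteq> adjacent_transpositions n"
      using Suc.prems(2) adjacent_transpositions_Suc_cases by blast
    with Suc.IH[OF Suc.prems(1)] perm show ?thesis by (blast intro: avoids_Suc_fixed)
  next
    case True
    then obtain us vs where gs: "gs = us @ ?s # vs" by (meson split_list)
    have sub: "set us \<subseteq> adjacent_transpositions n" "set vs \<subseteq> adjacent_transpositions n"
      using Suc.prems gs adjacent_transpositions_Suc_cases by auto
    have n: "1 \<le> n"
    proof -
      from True Suc.prems(2) obtain i where "?s = transpose i (i + 1)" "1 \<le> i" "i < Suc n"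
        by (auto simp: adjacent_transpositions_def)
      then show ?thesis by linarith
    qed
    let ?p = "foldr (\<circ>) (us @ vs) id"
    have av: "avoids_321_3412 n ?p"
      using Suc.prems gs sub by (intro Suc.IH) auto
    have p: "?p permutes {1..n}" using sub by (intro perm) auto
    have eq: "foldr (\<circ>) gs id = foldr (\<circ>) us id \<circ> ?s \<circ> foldr (\<circ>) vs id"
      unfolding gs by (simp only: foldr_comp_append) (simp add: comp_assoc)
    \<comment> \<open>By distinctness s_(n-1) occurs on at most one side of s_n. Moving s_n out
      through the other side leaves the same \<open>?p\<close> in both cases.\<close>
    have "transpose (n - 1) n \<notin> set us \<or> transpose (n - 1) n \<notin> set vs"
      using Suc.prems(1) gs by auto
    then show ?thesis
    proof
      assume "transpose (n - 1) n \<notin> set us"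
      from transpose_commutes_foldr[OF sub(1) this]
      have "foldr (\<circ>) gs id = ?s \<circ> ?p"
        unfolding eq by (simp only: foldr_comp_append comp_assoc[symmetric])
      then show ?thesis using avoids_top_transpose_comp[OF p av n] by (simp only:)
    next
      assume "transpose (n - 1) n \<notin> set vs"
      from transpose_commutes_foldr[OF sub(2) this]
      have "foldr (\<circ>) gs id = ?p \<circ> ?s"
        unfolding eq by (simp only: foldr_comp_append comp_assoc)
      then show ?thesis using avoids_comp_top_transpose[OF p av n] by (simp only:)
    qed
  qed
qed

section \<open>Short adjacent words for avoiding permutations\<close>

text \<open>Let \<open>j\<close> and \<open>m\<close> be the positions of n+1 and \<open>n\<close>.
  If both alternatives fail, then j < n and m < n+1. If j < m, positions j, m, n+1 carry 321. If m <
  j, the last two entries decide: a descent gives 321 at j, n, n+1, an ascent gives 3412 at m, j, n,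
  n+1.\<close>

lemma avoids_top_cases:
  assumes w: "w permutes {1..Suc n}" and av: "avoids_321_3412 (Suc n) w"
    and ne: "w (Suc n) \<noteq> Suc n"
  shows "1 \<le> n" "w (Suc n) = n \<or> w n = Suc n"
proof -
  define j where "j = inv w (Suc n)"
  have wj: "w j = Suc n" unfolding j_def using permutes_inverses(1)[OF w] by blast
  have "j \<in> {1..Suc n}" using permutes_in_image[OF w, of j] wj by simp
  with wj ne have j: "1 \<le> j" "j \<le> n" by (auto simp: le_Suc_eq)
  then show n: "1 \<le> n" by simp
  define m where "m = inv w n"
  have wm: "w m = n" unfolding m_def using permutes_inverses(1)[OF w] by blast
  have m: "m \<in> {1..Suc n}" using permutes_in_image[OF w, of m] wm n by simp
  have inj: "w a = w b \<Longrightarrow> a = b" for a b using permutes_inj[OF w] by (simp add: inj_eq)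
  have le: "w a \<le> Suc n" if "a \<le> Suc n" for a using permutes_le[OF w that] .
  have lt: "w a < n" if "a \<le> Suc n" "a \<noteq> m" "a \<noteq> j" for a
    using le[OF that(1)] inj[of a m] inj[of a j] wm wj that by linarith
  show "w (Suc n) = n \<or> w n = Suc n"
  proof (rule ccontr)
    assume "\<not> ?thesis"
    then have neq: "m \<noteq> Suc n" "j \<noteq> n" using wm wj by auto
    have jn: "j < n" using j neq by simp
    have mj: "m \<noteq> j" using wm wj by auto
    show False
    proof (cases "m < j")
      case True
      have "w n < w (Suc n)"
      proof (rule ccontr)
        assume "\<not> ?thesis"
        then have "w (Suc n) < w n" using inj[of n "Suc n"] by (metis n_not_Suc_n nat_neq_iff)
        moreover have "w n < w j" using lt[of n] jn True wj by simp
        ultimately show False using av j jn unfolding avoids_321_3412_def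
          by (meson lessI order_refl)
      qed
      moreover have "w (Suc n) < w m" using lt[of "Suc n"] neq jn wm by simp
      moreover have "w m < w j" using wm wj by simp
      moreover have "1 \<le> m" using m by simp
      ultimately show False using av True jn unfolding avoids_321_3412_def
        by (meson lessI order_refl)
    next
      case False
      then have "j < m" "m < Suc n" using mj m neq by auto
      moreover have "w (Suc n) < w m" using lt[of "Suc n"] neq jn wm by simp
      moreover have "w m < w j" using wm wj by simp
      ultimately show False using av j unfolding avoids_321_3412_def
        by (meson order_refl)
    qed
  qed
qed

text \<open>This is length_S <= length_T, phrased with words so that the induction can strip s_n
  from the left or the right. Restoring s_n adds one both to the length of the adjacent word and to
  the lower bound for reflection words.\<close>

lemma avoids_imp_short_word:
  assumes "w permutes {1..n}" "avoids_321_3412 n w"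
  shows "\<exists>k. is_word_of_length (adjacent_transpositions n) k w \<and>
    (\<forall>k'. is_word_of_length (transpositions n) k' w \<longrightarrow> k \<le> k')"
  using assms
proof (induction n arbitrary: w)
  case 0
  then have "w = id" by simp
  then show ?case using is_word_id by blast
next
  case (Suc n)
  note w = Suc.prems(1)
  let ?s = "transpose n (Suc n)"
  have s: "?s permutes {1..Suc n}" if "1 \<le> n"
    using that by (intro permutes_swap_id) auto
  have s_in: "?s \<in> adjacent_transpositions (Suc n)" if "1 \<le> n"
    using that by (auto simp: adjacent_transpositions_def)
  note mono = is_word_mono[OF _ adjacent_transpositions_Suc_mono]
  consider (fixed) "w (Suc n) = Suc n"
    | (last) "1 \<le> n" "w (Suc n) = n"
    | (penultimate) "1 \<le> n" "w n = Suc n"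
    using avoids_top_cases[OF Suc.prems] by blast
  then show ?case
  proof cases
    case fixed
    then have p: "w permutes {1..n}" by (rule permutes_Suc_fixed[OF w])
    have "avoids_321_3412 n w"
      by (rule avoids_321_3412_embedding[OF Suc.prems(2), of _ id]) auto
    from Suc.IH[OF p this] obtain k
      where k: "is_word_of_length (adjacent_transpositions n) k w"
        "\<And>k'. is_word_of_length (transpositions n) k' w \<Longrightarrow> k \<le> k'" by blast
    from mono[OF k(1)] show ?thesis
      using transposition_word_fixed[OF _ p] k(2) by (meson order_trans)
  next
    case last
    let ?p = "?s \<circ> w"
    have w_eq: "w = ?s \<circ> ?p" by (simp add: comp_assoc[symmetric])
    have p: "?p permutes {1..n}"
      using last by (intro permutes_Suc_fixed[OF permutes_compose[OF w s]]) auto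
    have "avoids_321_3412 n ?p"
    proof (rule avoids_321_3412_embedding[OF Suc.prems(2), of _ id])
      fix a b assume ab: "a \<in> {1..n}" "b \<in> {1..n}" "?p a < ?p b"
      \<comment> \<open>The value \<open>n\<close> is already taken at position n+1. On the first
        \<open>n\<close> positions s_n therefore only lowers n+1 to the missing value
        \<open>n\<close>, which keeps the order.\<close>
      have "w a \<noteq> n" "w b \<noteq> n"
        using last(2) permutes_inj[OF w] ab by (metis inj_eq atLeastAtMost_iff not_less_eq_eq order_refl)+
      moreover have "w a \<le> Suc n" "w b \<le> Suc n" using permutes_le[OF w] ab by auto
      ultimately show "w (id a) < w (id b)"
        using ab(3) by (auto simp: transpose_def split: if_splits)
    qed auto
    from Suc.IH[OF p this] obtain k
      where k: "is_word_of_length (adjacent_transpositions n) k ?p"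
        "\<And>k'. is_word_of_length (transpositions n) k' ?p \<Longrightarrow> k \<le> k'" by blast
    have "is_word_of_length (adjacent_transpositions (Suc n)) (Suc k) w"
      using is_word_Cons[OF s_in[OF last(1)] mono[OF k(1)]] by (simp only: flip: w_eq)
    moreover have "Suc k \<le> k'" if "is_word_of_length (transpositions (Suc n)) k' w" for k'
    proof -
      have "w = transpose (Suc n) n \<circ> ?p" by (subst w_eq) (simp only: transpose_commute)
      with that have "is_word_of_length (transpositions (Suc n)) k' (transpose (Suc n) n \<circ> ?p)"
        by (simp only:)
      from transposition_word_moved[OF this p] last(1) k(2) show ?thesis
        by (fastforce simp: Suc_le_eq)
    qed
    ultimately show ?thesis by blast
  next
    case penultimate
    let ?p = "w \<circ> ?s"
    have w_eq: "w = ?p \<circ> ?s" by (simp add: comp_assoc)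
    have p: "?p permutes {1..n}"
      using penultimate by (intro permutes_Suc_fixed[OF permutes_compose[OF s w]]) auto
    \<comment> \<open>\<open>f\<close> skips position \<open>n\<close>, where n+1 stands:
      \<open>?p\<close> is the one-line notation of \<open>w\<close> with that entry
      deleted.\<close>
    define f where "f i = (if i = n then Suc n else i)" for i
    have "avoids_321_3412 n ?p"
    proof (rule avoids_321_3412_embedding[OF Suc.prems(2), of _ f])
      fix a b assume "a \<in> {1..n}" "b \<in> {1..n}" "?p a < ?p b"
      then show "w (f a) < w (f b)" by (auto simp: f_def transpose_def split: if_splits)
    qed (auto simp: f_def)
    from Suc.IH[OF p this] obtain k
      where k: "is_word_of_length (adjacent_transpositions n) k ?p"
        "\<And>k'. is_word_of_length (transpositions n) k' ?p \<Longrightarrow> k \<le> k'" by blast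
    have "is_word_of_length (adjacent_transpositions (Suc n)) (Suc k) w"
      using is_word_snoc[OF s_in[OF penultimate(1)] mono[OF k(1)]] by (simp only: flip: w_eq)
    moreover have "Suc k \<le> k'" if "is_word_of_length (transpositions (Suc n)) k' w" for k'
    proof -
      \<comment> \<open>The lower bound expects the transposition on the left, so s_n is conjugated
        through \<open>?p\<close>; since \<open>?p\<close> fixes n+1, the result still involves
        n+1.\<close>
      have "w = transpose (?p n) (?p (Suc n)) \<circ> ?p"
        using w_eq comp_transpose_eq[OF permutes_bij[OF p], of n "Suc n"] by simp
      also have "transpose (?p n) (?p (Suc n)) = transpose (Suc n) (?p n)"
        using permutes_not_in[OF p, of "Suc n"] by (simp add: transpose_commute)
      finally have "w = transpose (Suc n) (?p n) \<circ> ?p" .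
      with that have "is_word_of_length (transpositions (Suc n)) k' (transpose (Suc n) (?p n) \<circ> ?p)"
        by (simp only:)
      moreover have "?p n \<in> {1..n}" using permutes_in_image[OF p, of n] penultimate(1) by simp
      ultimately obtain k'' where "k'' < k'" "is_word_of_length (transpositions n) k'' ?p"
        using transposition_word_moved[OF _ p] by blast
      with k(2) show ?thesis by (fastforce simp: Suc_le_eq)
    qed
    ultimately show ?thesis by blast
  qed
qed

theorem theorem4p7:
  fixes n :: nat and w :: "nat \<Rightarrow> nat"
  assumes "w permutes {1..n}"
  shows "length_S n w = length_T n w \<longleftrightarrow>
    avoids_pattern n w 3 (one_line [3, 2, 1]) \<and> avoids_pattern n w 4 (one_line [3, 4, 1, 2])"
  unfolding avoids_321_3412_iff[symmetric]
proof
  have S: "is_word_of_length (adjacent_transpositions n) (length_S n w) w"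
    unfolding length_S_def using adjacent_word_exists[OF assms] is_word_of_word_length by blast
  \<comment> \<open>Adjacent words are reflection words. This yields length_T <= length_S and also
    shows that the minimum defining \<open>length_T\<close> is attained.\<close>
  then have S': "is_word_of_length (transpositions n) (length_S n w) w"
    using is_word_mono adjacent_transpositions_subset by blast
  {
    assume eq: "length_S n w = length_T n w"
    obtain gs where gs: "length gs = length_S n w" "set gs \<subseteq> adjacent_transpositions n"
      "w = foldr (\<circ>) gs id"
      using S by (auto simp: is_word_of_length_def)
    have "distinct gs"
    proof (rule distinct_of_length_T)
      show "set gs \<subseteq> transpositions n" using gs(2) adjacent_transpositions_subset by blast
      show "length gs \<le> word_length (transpositions n) (foldr (\<circ>) gs id)"
        using gs(1) eq unfolding length_T_def gs(3)[symmetric] by simp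
    qed
    from avoids_of_distinct[OF this gs(2)] gs(3) show "avoids_321_3412 n w" by simp
  next
    assume "avoids_321_3412 n w"
    from avoids_imp_short_word[OF assms this] obtain k
      where k: "is_word_of_length (adjacent_transpositions n) k w"
        "\<And>k'. is_word_of_length (transpositions n) k' w \<Longrightarrow> k \<le> k'" by blast
    have "length_S n w \<le> k" unfolding length_S_def using k(1) by (rule word_length_le)
    also have "k \<le> length_T n w"
      unfolding length_T_def using k(2) is_word_of_word_length[OF S'] by blast
    finally show "length_S n w = length_T n w"
      using word_length_le[OF S'] by (simp add: length_T_def)
  }
qed

end
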